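(* Let $r\ge 2$ be a fixed integer and let $\Pi_n$ be a permutation chosen uniformly at random from all $n!$ permutations of $[n]=\{1,\dots,n\}$. Then, asymptotically almost surely as $n\to\infty$, $$tt^{(r)}(\Pi_n)=\left(\frac{1}{r-1}+o(1)\right)\frac{\log n}{\log\log n}\quad\text{and}\quad btt^{(r)}(\Pi_n)=\left(\frac{1}{r-1}+o(1)\right)\frac{\log n}{\log\log n}.$$
   Context: A permutation is any finite sequence of distinct integers. Two permutations $(x_1,\dots,x_k)$ and $(y_1,\dots,y_k)$ of the same length are similar if $x_i<x_j$ if and only if $y_i<y_j$ for all $1\le i<j\le k$. A block in a permutation $\pi$ is a subsequence of $\pi$ occupying a non-empty segment of consecutive positions. A collection of $r$ pairwise disjoint (occupying pairwise disjoint sets of positions), pairwise similar subsequences of $\pi$, each of length $k$, forms tight $r$-twins of length $k$ in $\pi$ if the union of the positions they occupy is a segment of consecutive positions (of length $rk$). If moreover each of the $r$ subsequences is itself a block (so that $r$ pairwise similar blocks of length $k$ occur consecutively in $\pi$ with no gaps in between), they form block-tight $r$-twins of length $k$. Let $tt^{(r)}(\pi)$ (respectively $btt^{(r)}(\pi)$) be the largest $k$ such that $\pi$ contains tight (respectively block-tight) $r$-twins of length $k$. An event $\mathcal{E}_n$ in the uniform probability space of all $n!$ permutations of $[n]$ holds asymptotically almost surely (a.a.s.) if $\mathbb{P}(\mathcal{E}_n)\to1$ as $n\to\infty$. A statement "a.a.s. $X_n=(c+o(1))a_n$" means that for every $\varepsilon>0$, $\mathbb{P}\big((c-\varepsilon)a_n\le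 X_n\le (c+\varepsilon)a_n\big)\to1$ as $n\to\infty$. *)

theory Defs
  imports "HOL-Probability.Probability" "HOL-Combinatorics.Combinatorics"
begin

text \<open>
  A permutation is a distinct list of integers. Positions are numbered from 0, and the
  subsequence of \<open>p\<close> occupying the set of positions \<open>S\<close> is \<open>nths p S\<close>.
\<close>

definition similar :: "int list \<Rightarrow> int list \<Rightarrow> bool" where
  "similar xs ys \<longleftrightarrow> length xs = length ys \<and>
     (\<forall>i j. i < j \<and> j < length xs \<longrightarrow> (xs ! i < xs ! j \<longleftrightarrow> ys ! i < ys ! j))"

text \<open>
  A collection of subsequences is given by the set \<open>C\<close> of the position sets they occupy.
  For \<open>r \<ge> 2\<close> this forces \<open>k \<ge> 1\<close>, since \<open>r\<close> distinct position sets cannot all be empty.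
\<close>

definition tight_twins :: "nat \<Rightarrow> nat \<Rightarrow> int list \<Rightarrow> nat set set \<Rightarrow> bool" where
  "tight_twins r k p C \<longleftrightarrow>
     card C = r \<and>
     (\<forall>S\<in>C. S \<subseteq> {..<length p} \<and> card S = k) \<and>
     disjoint C \<and>
     pairwise (\<lambda>S T. similar (nths p S) (nths p T)) C \<and>
     (\<exists>a. \<Union>C = {a..<a + r * k} \<and> a + r * k \<le> length p)"

definition block_tight_twins :: "nat \<Rightarrow> nat \<Rightarrow> int list \<Rightarrow> nat set set \<Rightarrow> bool" where
  "block_tight_twins r k p C \<longleftrightarrow>
     tight_twins r k p C \<and> (\<forall>S\<in>C. \<exists>b. S = {b..<b + k} \<and> S \<noteq> {})"

text \<open>
  For \<open>r \<ge> 2\<close> the added 0 only matters when there are no twins of any length,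
  i.e. when the permutation is shorter than \<open>r\<close>.
\<close>

definition tt :: "nat \<Rightarrow> int list \<Rightarrow> nat" where
  "tt r p = Max (insert 0 {k. \<exists>C. tight_twins r k p C})"

definition btt :: "nat \<Rightarrow> int list \<Rightarrow> nat" where
  "btt r p = Max (insert 0 {k. \<exists>C. block_tight_twins r k p C})"

definition random_perm :: "nat \<Rightarrow> int list pmf" where
  "random_perm n = pmf_of_set (permutations_of_set {1..int n})"

definition aas :: "(nat \<Rightarrow> int list \<Rightarrow> bool) \<Rightarrow> bool" where
  "aas E \<longleftrightarrow> (\<lambda>n. measure_pmf.prob (random_perm n) {p. E n p}) \<longlonglongrightarrow> 1"

text \<open>A.a.s. \<open>X(\<Pi>\<^sub>n) = (c + o(1)) a\<^sub>n\<close>.\<close>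

definition aas_asymp :: "(int list \<Rightarrow> nat) \<Rightarrow> real \<Rightarrow> (nat \<Rightarrow> real) \<Rightarrow> bool" where
  "aas_asymp X c a \<longleftrightarrow>
     (\<forall>\<epsilon>>0. aas (\<lambda>n p. (c - \<epsilon>) * a n \<le> real (X p) \<and> real (X p) \<le> (c + \<epsilon>) * a n))"

end

theory Submission
  imports Defs "HOL-Real_Asymp.Real_Asymp"
begin

text \<open>
  Write \<open>r = m + 1\<close>. The whole proof rests on one probability: \<open>r\<close> disjoint subsequences of
  length \<open>k\<close> at fixed positions of a random permutation are pairwise similar with probability
  \<open>1 / (k!)\<^sup>m\<close>, because the first one may have any pattern and each of the \<open>m\<close> others must then
  repeat it. Since block-tight twins are tight twins, \<open>btt \<le> tt\<close>, so it is enough to bound \<open>tt\<close> from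
  above and \<open>btt\<close> from below (\<open>aas_asymp_between_btt_tt\<close>).

  The upper bound is a first moment estimate (\<open>prob_tight_twins_le\<close>). There are at most \<open>n\<close>
  segments of length \<open>r k\<close> and at most \<open>r ^ (r k)\<close> ways to split one into \<open>r\<close> position sets, so tight
  twins of length \<open>k\<close> exist with probability at most \<open>n r ^ (r k) / (k!)\<^sup>m\<close>. The choice of the splitting
  costs only a factor exponential in \<open>k\<close>, negligible against the factorial; this is why general tight
  twins are asymptotically no longer than block-tight ones.

  The lower bound uses independence (\<open>prob_no_block_tight_twins_le\<close>). About \<open>n / (r k)\<close> disjoint
  segments of length \<open>r k\<close> have independent order patterns, so the probability that none of them consists
  of \<open>r\<close> similar blocks is \<open>(1 - 1 / (k!)\<^sup>m) ^ (n / (r k))\<close> up to rounding, hence at most about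
  \<open>exp (- n / (r k (k!)\<^sup>m))\<close>.

  Both estimates change behaviour where \<open>(k!)\<^sup>m = n ^ (1 + o(1))\<close>. Since
  \<open>ln (k!)\<close> is asymptotic to \<open>k ln k\<close>, this is \<open>k = (1 / m + o(1)) ln n / ln (ln n)\<close>
  (\<open>twin_scale_ln_twin_scale\<close>).
\<close>

section \<open>Order patterns\<close>

text \<open>
  The list of relative ranks is the canonical form of an order pattern: similarity becomes an
  equality of lists, and arrangements with a given pattern become a fibre of \<open>ranks\<close>.
\<close>
definition ranks :: "'a::linorder list \<Rightarrow> nat list" where
  "ranks xs = map (\<lambda>x. card {y \<in> set xs. y < x}) xs"

lemma length_ranks [simp]: "length (ranks xs) = length xs"
  by (simp add: ranks_def)

lemma card_below_less_iff:
  fixes x y :: "'a::linorder"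
  assumes "finite A" "x \<in> A" "y \<in> A"
  shows "card {z \<in> A. z < x} < card {z \<in> A. z < y} \<longleftrightarrow> x < y"
proof
  assume "x < y"
  then have "{z \<in> A. z < x} \<subset> {z \<in> A. z < y}" using assms by auto
  then show "card {z \<in> A. z < x} < card {z \<in> A. z < y}"
    using assms by (intro psubset_card_mono) auto
next
  assume *: "card {z \<in> A. z < x} < card {z \<in> A. z < y}"
  show "x < y"
  proof (rule ccontr)
    assume "\<not> x < y"
    then have "{z \<in> A. z < y} \<subseteq> {z \<in> A. z < x}" by auto
    then have "card {z \<in> A. z < y} \<le> card {z \<in> A. z < x}"
      using assms by (intro card_mono) auto
    with * show False by simp
  qed
qed

lemma nth_ranks:
  assumes "distinct xs" "i < length xs"
  shows "ranks xs ! i = card {j. j < length xs \<and> xs ! j < xs ! i}"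
proof -
  have "{y \<in> set xs. y < xs ! i} = (!) xs ` {j. j < length xs \<and> xs ! j < xs ! i}"
    by (auto simp: in_set_conv_nth)
  moreover have "inj_on ((!) xs) {j. j < length xs \<and> xs ! j < xs ! i}"
    using assms by (auto simp: inj_on_def nth_eq_iff_index_eq)
  ultimately show ?thesis using assms by (simp add: ranks_def card_image)
qed

lemma nth_less_iff_ranks_less:
  assumes "i < length xs" "j < length xs"
  shows "xs ! i < xs ! j \<longleftrightarrow> ranks xs ! i < ranks xs ! j"
  using assms card_below_less_iff[of "set xs" "xs ! i" "xs ! j"] by (simp add: ranks_def)

text \<open>
  The relation \<open>similar\<close> compares only pairs \<open>i < j\<close>. Distinctness of the entries recovers the
  comparison for \<open>i > j\<close> as well, and then each rank, being the number of smaller entries, agrees.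
\<close>
lemma similar_iff_ranks_eq:
  assumes "distinct xs" "distinct ys"
  shows "similar xs ys \<longleftrightarrow> ranks xs = ranks ys"
proof
  assume sim: "similar xs ys"
  then have len: "length xs = length ys" by (simp add: similar_def)
  have iff: "xs ! j < xs ! i \<longleftrightarrow> ys ! j < ys ! i" if "i < length xs" "j < length xs" for i j
  proof (cases i j rule: linorder_cases)
    case less
    then have "xs ! i \<noteq> xs ! j" "ys ! i \<noteq> ys ! j"
      using assms that len by (auto simp: nth_eq_iff_index_eq)
    moreover have "xs ! i < xs ! j \<longleftrightarrow> ys ! i < ys ! j"
      using sim that less by (auto simp: similar_def)
    ultimately show ?thesis by auto
  next
    case greater
    then show ?thesis using sim that by (auto simp: similar_def)
  qed auto
  show "ranks xs = ranks ys"
    using iff len assms by (intro nth_equalityI) (auto simp: nth_ranks intro!: arg_cong[of _ _ card])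
next
  assume eq: "ranks xs = ranks ys"
  then have "length xs = length ys" by (metis length_ranks)
  then show "similar xs ys"
    using eq by (simp add: similar_def nth_less_iff_ranks_less[of _ xs] nth_less_iff_ranks_less[of _ ys])
qed

text \<open>
  On the arrangements of a fixed set \<open>A\<close>, taking ranks is the same as relabelling \<open>A\<close> by its unique
  increasing bijection onto an initial segment of the naturals. This is why each set of \<open>k\<close>
  values realises each of the \<open>k!\<close> patterns exactly once, which is the source of every
  factor \<open>1 / k!\<close> below.
\<close>
lemma bij_betw_ranks:
  fixes A :: "'a::linorder set"
  assumes "finite A"
  shows "bij_betw ranks (permutations_of_set A) (permutations_of_set {..<card A})"
proof -
  define f where "f = (\<lambda>x. card {y \<in> A. y < x})"
  have inj: "inj_on f A"
  proof (rule inj_onI)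
    fix x y assume "x \<in> A" "y \<in> A" "f x = f y"
    then show "x = y"
      using card_below_less_iff[OF assms, of x y] card_below_less_iff[OF assms, of y x]
      by (auto simp: f_def)
  qed
  have "f x < card A" if "x \<in> A" for x
    unfolding f_def using that assms by (intro psubset_card_mono) auto
  then have "f ` A = {..<card A}"
    using inj by (intro card_subset_eq) (auto simp: card_image)
  moreover have "inj_on (map f) (permutations_of_set A)"
    using inj by (intro inj_onI) (auto simp: permutations_of_set_def intro: inj_on_map_eq_map[THEN iffD1])
  ultimately have "bij_betw (map f) (permutations_of_set A) (permutations_of_set {..<card A})"
    using permutations_of_set_image_inj[OF inj] by (simp add: bij_betw_def)
  moreover have "ranks xs = map f xs" if "xs \<in> permutations_of_set A" for xs
    using permutations_of_setD[OF that] by (simp add: ranks_def f_def)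
  ultimately show ?thesis by (simp cong: bij_betw_cong)
qed

lemma card_arrangements_with_ranks:
  assumes "finite A" "distinct ys" "length ys = card A"
  shows "card {xs \<in> permutations_of_set A. ranks xs = ranks ys} = 1"
proof -
  note bij = bij_betw_ranks[OF assms(1)]
  have "ranks ys \<in> permutations_of_set {..<card A}"
    using bij_betwE[OF bij_betw_ranks[of "set ys"]] assms by (auto simp: distinct_card)
  then obtain zs where zs: "zs \<in> permutations_of_set A" "ranks zs = ranks ys"
    using bij by (metis (no_types, lifting) bij_betw_def imageE)
  then have "{xs \<in> permutations_of_set A. ranks xs = ranks ys} = {zs}"
    using bij by (auto simp: bij_betw_def inj_on_def)
  then show ?thesis by simp
qed

section \<open>Patterns of blocks in a uniformly random arrangement\<close>

text \<open>
  Conditioning on the set \<open>B\<close> of values in the first \<open>k\<close> places: given \<open>B\<close>, the two parts are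
  arbitrary arrangements of \<open>B\<close> and of its complement. If the conditional probability \<open>q\<close>
  of \<open>R\<close> is the same for every \<open>B\<close>, then it is the probability of \<open>R\<close>. This is the only form of
  independence that the proof uses.
\<close>
lemma card_permutations_split:
  fixes A :: "'a set"
  assumes A: "finite A" and k: "k \<le> card A"
    and R: "\<And>B. B \<subseteq> A \<Longrightarrow> card B = k \<Longrightarrow>
      real (card {z \<in> permutations_of_set B \<times> permutations_of_set (A - B). R (fst z) (snd z)})
        = q * fact k * fact (card A - k)"
  shows "real (card {p \<in> permutations_of_set A. R (take k p) (drop k p)}) = q * fact (card A)"
proof -
  define T where "T = (\<lambda>B. {z \<in> permutations_of_set B \<times> permutations_of_set (A - B). R (fst z) (snd z)})"
  define I where "I = {B. B \<subseteq> A \<and> card B = k}"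
  have finI: "finite I" using A by (simp add: I_def)
  have finT: "finite (T B)" for B by (simp add: T_def)
  have len: "length (fst z) = k" if "B \<in> I" "z \<in> T B" for B z
    using that by (auto simp: I_def T_def length_finite_permutations_of_set)
  \<comment> \<open>All first components have length \<open>k\<close>, so the place where to cut a concatenation is known.\<close>
  have "inj_on (\<lambda>z. fst z @ snd z) (\<Union>B\<in>I. T B)"
  proof (rule inj_onI)
    fix z w assume zw: "z \<in> (\<Union>B\<in>I. T B)" "w \<in> (\<Union>B\<in>I. T B)" "fst z @ snd z = fst w @ snd w"
    then have "length (fst z) = length (fst w)" using len by (metis UN_E)
    with zw show "z = w" by (simp add: prod_eq_iff)
  qed
  moreover have "{p \<in> permutations_of_set A. R (take k p) (drop k p)}
      = (\<lambda>z. fst z @ snd z) ` (\<Union>B\<in>I. T B)" (is "?L = ?R")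
  proof (intro set_eqI iffI)
    fix p assume p: "p \<in> ?L"
    then have p': "set p = A" "distinct p" "length p = card A"
      by (auto simp: permutations_of_set_def distinct_card)
    define B where "B = set (take k p)"
    have "set (take k p) \<union> set (drop k p) = A" "set (take k p) \<inter> set (drop k p) = {}"
      using p' by (metis append_take_drop_id set_append, simp add: set_take_disj_set_drop_if_distinct)
    then have "set (drop k p) = A - B" by (auto simp: B_def)
    moreover have "B \<subseteq> A" using p' set_take_subset by (auto simp: B_def dest: in_set_takeD)
    moreover have "card B = k" using p' k by (simp add: B_def distinct_card)
    ultimately have "B \<in> I" "(take k p, drop k p) \<in> T B"
      using p p' by (auto simp: I_def T_def B_def permutations_of_set_def)
    then show "p \<in> ?R" by (force intro!: image_eqI[of _ _ "(take k p, drop k p)"])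
  next
    fix p assume "p \<in> ?R"
    then obtain B z where B: "B \<in> I" "z \<in> T B" "p = fst z @ snd z" by blast
    then show "p \<in> ?L"
      using len[OF B(1,2)] by (auto simp: I_def T_def permutations_of_set_def)
  qed
  ultimately have "card {p \<in> permutations_of_set A. R (take k p) (drop k p)} = card (\<Union>B\<in>I. T B)"
    by (simp add: card_image)
  also have "\<dots> = (\<Sum>B\<in>I. card (T B))"
    using finI finT by (intro card_UN_disjoint) (auto simp: T_def permutations_of_set_def)
  finally have "real (card {p \<in> permutations_of_set A. R (take k p) (drop k p)})
      = (\<Sum>B\<in>I. real (card (T B)))" by simp
  also have "\<dots> = (\<Sum>B\<in>I. q * fact k * fact (card A - k))"
    using R by (intro sum.cong) (auto simp: I_def T_def)
  also have "\<dots> = real (card A choose k) * (q * fact k * fact (card A - k))"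
    using n_subsets[OF A, of k] by (simp add: I_def)
  also have "\<dots> = q * fact (card A)"
    using binomial_fact[OF k, where 'a = real] by simp
  finally show ?thesis .
qed

definition similar_blocks :: "nat \<Rightarrow> nat \<Rightarrow> 'a::linorder list \<Rightarrow> bool" where
  "similar_blocks k r p \<longleftrightarrow> (\<forall>i<r. ranks (take k (drop (i * k) p)) = ranks (take k p))"

lemma similar_blocks_1 [simp]: "similar_blocks k (Suc 0) p"
  by (simp add: similar_blocks_def)

text \<open>
  The first block is only compared with the second one; this makes the induction in the next
  count reveal one new block at a time.
\<close>
lemma similar_blocks_Suc_Suc:
  "similar_blocks k (Suc (Suc m)) p \<longleftrightarrow>
     ranks (take k p) = ranks (take k (drop k p)) \<and> similar_blocks k (Suc m) (drop k p)"
proof -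
  define b where "b = (\<lambda>i. ranks (take k (drop (i * k) p)))"
  have "similar_blocks k (Suc (Suc m)) p \<longleftrightarrow> (\<forall>i<Suc m. b (Suc i) = b 0)"
    by (simp add: similar_blocks_def b_def All_less_Suc2 del: mult_Suc)
  also have "\<dots> \<longleftrightarrow> b 0 = b 1 \<and> (\<forall>i<Suc m. b (Suc i) = b 1)"
    by (metis One_nat_def zero_less_Suc)
  also have "\<dots> \<longleftrightarrow> ranks (take k p) = ranks (take k (drop k p)) \<and> similar_blocks k (Suc m) (drop k p)"
    by (simp add: similar_blocks_def b_def add.commute)
  finally show ?thesis .
qed

lemma similar_blocks_take:
  assumes "r * k \<le> s"
  shows "similar_blocks k r (take s p) \<longleftrightarrow> similar_blocks k r p"
proof -
  have "take k (drop (i * k) (take s p)) = take k (drop (i * k) p)" if "i < r" for i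
  proof -
    have "i * k + k \<le> r * k" using that mult_le_mono1[of "Suc i" r k] by simp
    then have "k \<le> s - i * k" using assms by simp
    then show ?thesis by (simp add: drop_take min_def)
  qed
  moreover have "take k (take s p) = take k p" if "0 < r"
    using that assms by (cases r) (auto simp: min_def)
  ultimately show ?thesis by (auto simp: similar_blocks_def)
qed

text \<open>
  Given everything to its right, each block other than the last must be the one arrangement, out of
  the \<open>k!\<close> arrangements of its value set, that has the pattern of its right neighbour. With
  \<open>m + 1\<close> blocks this happens \<open>m\<close> times.
\<close>
lemma card_similar_blocks:
  fixes A :: "'a::linorder set"
  assumes "finite A" "Suc m * k \<le> card A"
  shows "real (card {p \<in> permutations_of_set A. similar_blocks k (Suc m) p})
    = (1 / fact k) ^ m * fact (card A)"
  using assms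
proof (induction m arbitrary: A)
  case 0
  then show ?case by simp
next
  case (Suc m)
  let ?R = "\<lambda>xs ys. ranks xs = ranks (take k ys) \<and> similar_blocks k (Suc m) ys"
  have "real (card {z \<in> permutations_of_set B \<times> permutations_of_set (A - B). ?R (fst z) (snd z)})
      = (1 / fact k) ^ Suc m * fact k * fact (card A - k)" if B: "B \<subseteq> A" "card B = k" for B
  proof -
    have fin: "finite B" "finite (A - B)" and cAB: "card (A - B) = card A - k"
      using B finite_subset[OF B(1) Suc.prems(1)] Suc.prems by (simp_all add: card_Diff_subset)
    define G where "G = {ys \<in> permutations_of_set (A - B). similar_blocks k (Suc m) ys}"
    \<comment> \<open>Once the rest is known, the pattern of the first block is forced.\<close>
    have one: "card {xs \<in> permutations_of_set B. ranks xs = ranks (take k ys)} = 1" if "ys \<in> G" for ys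
    proof (rule card_arrangements_with_ranks)
      show "distinct (take k ys)" "length (take k ys) = card B"
        using that cAB Suc.prems B
        by (auto simp: G_def permutations_of_set_def distinct_card[symmetric])
    qed (fact fin)
    have "{z \<in> permutations_of_set B \<times> permutations_of_set (A - B). ?R (fst z) (snd z)}
        = (\<lambda>(ys, xs). (xs, ys)) ` (SIGMA ys:G. {xs \<in> permutations_of_set B. ranks xs = ranks (take k ys)})"
      by (force simp: G_def)
    moreover have "inj_on (\<lambda>(ys, xs). (xs, ys)) X" for X :: "('a list \<times> 'a list) set"
      by (auto simp: inj_on_def)
    ultimately have "card {z \<in> permutations_of_set B \<times> permutations_of_set (A - B). ?R (fst z) (snd z)}
        = card (SIGMA ys:G. {xs \<in> permutations_of_set B. ranks xs = ranks (take k ys)})"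
      by (simp add: card_image)
    also have "\<dots> = (\<Sum>ys\<in>G. card {xs \<in> permutations_of_set B. ranks xs = ranks (take k ys)})"
      by (rule card_SigmaI) (auto simp: G_def)
    also have "\<dots> = card G" using one by simp
    finally show ?thesis
      using Suc.IH[OF fin(2)] Suc.prems cAB by (simp add: G_def)
  qed
  moreover have "k \<le> card A" using Suc.prems by simp
  ultimately show ?case
    using card_permutations_split[OF Suc.prems(1), of k ?R "(1 / fact k) ^ Suc m"]
    by (simp only: similar_blocks_Suc_Suc)
qed

text \<open>
  Disjoint segments have independent order patterns, so the probability that all \<open>N\<close> of them fail
  to split into similar blocks is a product.
\<close>
lemma card_no_similar_segment:
  fixes A :: "'a::linorder set"
  assumes "finite A" "N * (Suc m * k) \<le> card A"
  shows "real (card {p \<in> permutations_of_set A.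
      \<forall>j<N. \<not> similar_blocks k (Suc m) (drop (j * (Suc m * k)) p)})
    = (1 - (1 / fact k) ^ m) ^ N * fact (card A)"
  using assms
proof (induction N arbitrary: A)
  case 0
  then show ?case by simp
next
  case (Suc N)
  define s where "s = Suc m * k"
  let ?G = "\<lambda>ys. \<forall>j<N. \<not> similar_blocks k (Suc m) (drop (j * s) ys)"
  let ?R = "\<lambda>xs ys. \<not> similar_blocks k (Suc m) xs \<and> ?G ys"
  have s: "s \<le> card A" "N * s \<le> card A - s" using Suc.prems by (auto simp: s_def)
  have "real (card {z \<in> permutations_of_set B \<times> permutations_of_set (A - B). ?R (fst z) (snd z)})
      = (1 - (1 / fact k) ^ m) ^ Suc N * fact s * fact (card A - s)" if B: "B \<subseteq> A" "card B = s" for B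
  proof -
    have fin: "finite B" "finite (A - B)" and cAB: "card (A - B) = card A - s"
      using B finite_subset[OF B(1) Suc.prems(1)] Suc.prems by (simp_all add: card_Diff_subset)
    let ?S = "{xs \<in> permutations_of_set B. similar_blocks k (Suc m) xs}"
    have "{z \<in> permutations_of_set B \<times> permutations_of_set (A - B). ?R (fst z) (snd z)}
        = (permutations_of_set B - ?S) \<times> {ys \<in> permutations_of_set (A - B). ?G ys}"
      by auto
    moreover have "real (card (permutations_of_set B - ?S)) = (1 - (1 / fact k) ^ m) * fact s"
    proof -
      have "card (permutations_of_set B - ?S) + card ?S = card (permutations_of_set B)"
        by (subst card_Un_disjoint[symmetric]) (auto intro: arg_cong[of _ _ card])
      also have "\<dots> = fact s" using fin B by simp
      finally have "real (card (permutations_of_set B - ?S) + card ?S) = real (fact s)"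
        by (rule arg_cong)
      moreover have "real (card ?S) = (1 / fact k) ^ m * fact s"
        using card_similar_blocks[OF fin(1), of m k] B by (simp add: s_def)
      ultimately show ?thesis by (simp add: left_diff_distrib)
    qed
    moreover have "real (card {ys \<in> permutations_of_set (A - B). ?G ys})
        = (1 - (1 / fact k) ^ m) ^ N * fact (card A - s)"
      using Suc.IH[OF fin(2)] s cAB by (simp add: s_def)
    ultimately show ?thesis by (simp add: card_cartesian_product)
  qed
  from card_permutations_split[OF Suc.prems(1) s(1) this]
  have "real (card {p \<in> permutations_of_set A. ?R (take s p) (drop s p)})
      = (1 - (1 / fact k) ^ m) ^ Suc N * fact (card A)" .
  moreover have "?R (take s p) (drop s p) \<longleftrightarrow>
      (\<forall>j<Suc N. \<not> similar_blocks k (Suc m) (drop (j * s) p))" for p :: "'a list"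
    using similar_blocks_take[of "Suc m" k s p] by (simp add: s_def All_less_Suc2 add.commute)
  ultimately show ?case by (simp add: s_def)
qed

section \<open>Twins at arbitrary positions\<close>

lemma block_concat:
  assumes "\<And>xs. xs \<in> set xss \<Longrightarrow> length xs = k" "i < length xss"
  shows "take k (drop (i * k) (concat xss @ zs)) = xss ! i"
  using assms
proof (induction xss arbitrary: i)
  case (Cons xs xss)
  then show ?case by (cases i) auto
qed simp

lemma nths_conv_map_sorted_list_of_set:
  assumes "S \<subseteq> {..<length p}"
  shows "nths p S = map ((!) p) (sorted_list_of_set S)"
proof -
  have "nths p S = nths (map ((!) p) [0..<length p]) S" by (simp add: map_nth)
  also have "\<dots> = map ((!) p) (nths [0..<length p] S)" by (simp add: nths_map)
  also have "nths [0..<length p] S = sorted_list_of_set S"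
  proof (rule sorted_distinct_set_unique)
    have "{i. i < length [0..<length p] \<and> [0..<length p] ! i \<in> S} = S" using assms by auto
    then have "nths [0..<length p] S = filter (\<lambda>i. i \<in> S) [0..<length p]"
      by (simp only: filter_eq_nths)
    then show "set (nths [0..<length p] S) = set (sorted_list_of_set S)"
      using assms finite_subset[OF assms finite_lessThan] by auto
  qed (auto intro: sorted_nths)
  finally show ?thesis .
qed

lemma card_permutations_reindex_le:
  fixes A :: "'a set"
  assumes L: "distinct L" "set L = {..<card A}" and A: "finite A"
  shows "card {p \<in> permutations_of_set A. Q (map ((!) p) L)} \<le> card {p \<in> permutations_of_set A. Q p}"
proof (rule card_inj_on_le)
  let ?S = "{p \<in> permutations_of_set A. Q (map ((!) p) L)}"
  have len: "length p = card A" if "p \<in> ?S" for p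
    using that by (auto intro: length_finite_permutations_of_set)
  show "inj_on (\<lambda>p. map ((!) p) L) ?S"
  proof (rule inj_onI)
    fix p q assume pq: "p \<in> ?S" "q \<in> ?S" "map ((!) p) L = map ((!) q) L"
    then have "\<forall>i<card A. p ! i = q ! i" using L by auto
    with len[OF pq(1)] len[OF pq(2)] show "p = q" by (intro nth_equalityI) auto
  qed
  show "(\<lambda>p. map ((!) p) L) ` ?S \<subseteq> {p \<in> permutations_of_set A. Q p}"
  proof safe
    fix p assume p: "p \<in> permutations_of_set A"
    then have p': "set p = A" "distinct p" "length p = card A"
      by (auto simp: permutations_of_set_def distinct_card)
    have "inj_on ((!) p) (set L)" using p' L by (auto simp: inj_on_def nth_eq_iff_index_eq)
    moreover have "(!) p ` set L = A" using nth_image[of "length p" p] p' L by (simp add: lessThan_atLeast0)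
    ultimately show "map ((!) p) L \<in> permutations_of_set A"
      using L by (auto simp: permutations_of_set_def distinct_map)
  qed
qed (use A in auto)

text \<open>
  A rearrangement of the positions preserves the uniform distribution. Moving the positions
  of \<open>S 0\<close>, ..., \<open>S m\<close>, in this order, to the front turns the given subsequences into the first
  \<open>m + 1\<close> blocks, so scattered subsequences are no more likely to be similar than consecutive blocks.
\<close>
lemma card_similar_at_positions_le:
  assumes A: "finite (A :: int set)"
    and S: "\<And>i. i \<le> m \<Longrightarrow> S i \<subseteq> {..<card A} \<and> card (S i) = k"
    and disj: "disjoint_family_on S {..m}"
  shows "real (card {p \<in> permutations_of_set A. \<forall>i\<le>m. \<forall>j\<le>m. similar (nths p (S i)) (nths p (S j))})
    \<le> (1 / fact k) ^ m * fact (card A)"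
proof -
  have finS: "finite (S i)" if "i \<le> m" for i using S[OF that] finite_subset by blast
  define U where "U = (\<Union>i\<le>m. S i)"
  have U: "U \<subseteq> {..<card A}" using S by (auto simp: U_def)
  have "card U = (\<Sum>i\<le>m. card (S i))"
    unfolding U_def using finS disj by (intro card_UN_disjoint) (auto simp: disjoint_family_on_def)
  also have "\<dots> = Suc m * k" using S by simp
  finally have cardU: "card U = Suc m * k" .
  have total: "Suc m * k \<le> card A"
    using card_mono[OF finite_lessThan U] by (simp add: cardU)
  define xss where "xss = map (\<lambda>i. sorted_list_of_set (S i)) [0..<Suc m]"
  define zs where "zs = sorted_list_of_set ({..<card A} - U)"
  define L where "L = concat xss @ zs"
  have "set (concat xss) = U"
    using finS by (auto simp: U_def xss_def less_Suc_eq_le simp del: upt_Suc)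
  then have setL: "set L = {..<card A}"
    using U by (auto simp: L_def zs_def)
  have "map length xss = map (\<lambda>_. k) [0..<Suc m]"
    using S by (simp add: xss_def del: upt_Suc)
  then have "length (concat xss) = Suc m * k" by (simp only: length_concat) (simp add: sum_list_triv)
  moreover have "card ({..<card A} - U) = card A - Suc m * k"
    using U finite_subset[OF U] by (simp add: card_Diff_subset cardU)
  ultimately have "length L = card {..<card A}"
    using total by (simp add: L_def zs_def)
  with setL have distL: "distinct L" by (metis card_distinct)
  have block: "take k (drop (i * k) (map ((!) p) L)) = nths p (S i)"
    if "i \<le> m" "p \<in> permutations_of_set A" for i p
  proof -
    have "take k (drop (i * k) L) = xss ! i"
      unfolding L_def using S that by (intro block_concat) (auto simp: xss_def)
    also have "xss ! i = sorted_list_of_set (S i)"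
      using that by (simp add: xss_def del: upt_Suc)
    finally show ?thesis
      using S[OF that(1)] that(2) length_finite_permutations_of_set[OF that(2)]
      by (simp add: take_map drop_map nths_conv_map_sorted_list_of_set)
  qed
  have "similar_blocks k (Suc m) (map ((!) p) L)"
    if p: "p \<in> permutations_of_set A" "\<forall>i\<le>m. \<forall>j\<le>m. similar (nths p (S i)) (nths p (S j))" for p
    unfolding similar_blocks_def
  proof (intro allI impI)
    fix i assume "i < Suc m"
    then have "ranks (nths p (S i)) = ranks (nths p (S 0))"
      using p by (subst similar_iff_ranks_eq[symmetric]) (auto simp: permutations_of_set_def)
    then show "ranks (take k (drop (i * k) (map ((!) p) L))) = ranks (take k (map ((!) p) L))"
      using block[of i p] block[of 0 p] p \<open>i < Suc m\<close> by simp
  qed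
  then have "card {p \<in> permutations_of_set A. \<forall>i\<le>m. \<forall>j\<le>m. similar (nths p (S i)) (nths p (S j))}
      \<le> card {p \<in> permutations_of_set A. similar_blocks k (Suc m) (map ((!) p) L)}"
    by (intro card_mono) auto
  also have "\<dots> \<le> card {p \<in> permutations_of_set A. similar_blocks k (Suc m) p}"
    by (rule card_permutations_reindex_le[OF distL setL A])
  finally have "real (card {p \<in> permutations_of_set A. \<forall>i\<le>m. \<forall>j\<le>m. similar (nths p (S i)) (nths p (S j))})
      \<le> real (card {p \<in> permutations_of_set A. similar_blocks k (Suc m) p})" by simp
  then show ?thesis using card_similar_blocks[OF A total] by simp
qed

definition colour_class :: "(nat \<Rightarrow> nat) \<Rightarrow> nat set \<Rightarrow> nat \<Rightarrow> nat set" where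
  "colour_class c W i = {x \<in> W. c x = i}"

text \<open>
  Ordering the members of the collection turns it into a colouring of the segment that it
  covers. Colourings are easy to count; that each collection arises from \<open>(m + 1)!\<close> of them and
  that many of them are unbalanced is harmless against \<open>(k!)\<^sup>m\<close>.
\<close>
lemma tight_twins_colouring:
  assumes tw: "tight_twins (Suc m) k p C" and "k > 0"
  obtains a c where "a < length p" "a + Suc m * k \<le> length p"
    "c \<in> {a..<a + Suc m * k} \<rightarrow>\<^sub>E {..m}"
    "\<And>i. i \<le> m \<Longrightarrow> card (colour_class c {a..<a + Suc m * k} i) = k"
    "\<And>i j. i \<le> m \<Longrightarrow> j \<le> m \<Longrightarrow>
      similar (nths p (colour_class c {a..<a + Suc m * k} i)) (nths p (colour_class c {a..<a + Suc m * k} j))"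
proof -
  have C: "card C = Suc m" "\<And>S. S \<in> C \<Longrightarrow> card S = k" "disjoint C"
    using tw by (auto simp: tight_twins_def)
  have sim: "similar (nths p S) (nths p T)" if "S \<in> C" "T \<in> C" for S T
    using tw that by (cases "S = T") (auto simp: tight_twins_def pairwise_def similar_def[of "nths p T" "nths p T"])
  obtain a where a: "\<Union>C = {a..<a + Suc m * k}" "a + Suc m * k \<le> length p"
    using tw by (auto simp: tight_twins_def)
  have "finite C" using C(1) card.infinite by fastforce
  then obtain h where h: "bij_betw h {..m} C"
    using ex_bij_betw_nat_finite[of C] C(1) by (auto simp: atLeast0LessThan lessThan_Suc_atMost)
  define W where "W = {a..<a + Suc m * k}"
  define c where "c = (\<lambda>x\<in>W. THE i. i \<le> m \<and> x \<in> h i)"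
  have uniq: "i = j" if "i \<le> m" "j \<le> m" "x \<in> h i" "x \<in> h j" for i j x
  proof -
    have "h i \<in> C" "h j \<in> C" using h that by (auto simp: bij_betw_def)
    then have "h i = h j" using C(3) that by (auto simp: disjoint_def)
    then show ?thesis using h that by (auto simp: bij_betw_def inj_on_def)
  qed
  have hW: "x \<in> W" if "i \<le> m" "x \<in> h i" for i x
    using h that a(1) by (auto simp: bij_betw_def W_def)
  \<comment> \<open>Disjointness makes the description that defines \<open>c\<close> unique.\<close>
  have c_eq: "c x = i" if "i \<le> m" "x \<in> h i" for i x
    using that hW uniq by (auto simp: c_def)
  have c_ex: "\<exists>i\<le>m. x \<in> h i" if "x \<in> W" for x
    using that h a(1) by (auto simp: bij_betw_def W_def)
  have class_eq: "colour_class c W i = h i" if "i \<le> m" for i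
    using that c_eq c_ex hW by (fastforce simp: colour_class_def)
  have hC: "h i \<in> C" if "i \<le> m" for i using h that by (auto simp: bij_betw_def)
  show ?thesis
  proof (rule that[of a c], fold W_def)
    show "a < length p" using a(2) \<open>k > 0\<close> by simp
    show "c \<in> W \<rightarrow>\<^sub>E {..m}" using c_eq c_ex by (auto simp: c_def PiE_def) fastforce
  qed (use a(2) class_eq C hC sim in auto)
qed

text \<open>
  The union bound over the starting points of the segment (at most \<open>card A\<close>) and over the
  \<open>(m + 1) ^ ((m + 1) * k)\<close> colourings of it.
\<close>
lemma card_tight_twins_le:
  assumes A: "finite (A :: int set)" and "k > 0"
  shows "real (card {p \<in> permutations_of_set A. \<exists>C. tight_twins (Suc m) k p C})
    \<le> card A * real (Suc m) ^ (Suc m * k) * (1 / fact k) ^ m * fact (card A)"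
proof -
  define n where "n = card A"
  define W where "W = (\<lambda>a. {a..<a + Suc m * k})"
  define I where "I = (SIGMA a:{a. a < n \<and> a + Suc m * k \<le> n}. {c \<in> W a \<rightarrow>\<^sub>E {..m}. \<forall>i\<le>m. card (colour_class c (W a) i) = k})"
  define E where "E = (\<lambda>(a, c). {p \<in> permutations_of_set A. \<forall>i\<le>m. \<forall>j\<le>m.
    similar (nths p (colour_class c (W a) i)) (nths p (colour_class c (W a) j))})"
  have finI: "finite I"
    unfolding I_def by (intro finite_SigmaI) (auto simp: W_def intro!: finite_PiE)
  have "card I \<le> card (SIGMA a:{..<n}. W a \<rightarrow>\<^sub>E {..m})"
    unfolding I_def by (intro card_mono finite_SigmaI) (auto simp: W_def intro!: finite_PiE)
  also have "\<dots> = n * Suc m ^ (Suc m * k)"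
    by (subst card_SigmaI) (auto simp: W_def card_PiE finite_PiE)
  finally have cardI: "real (card I) \<le> real (n * Suc m ^ (Suc m * k))" by (simp only: of_nat_le_iff)
  have "{p \<in> permutations_of_set A. \<exists>C. tight_twins (Suc m) k p C} \<subseteq> (\<Union>z\<in>I. E z)"
  proof safe
    fix p C assume p: "p \<in> permutations_of_set A" and "tight_twins (Suc m) k p C"
    then obtain a c where "a < length p" "a + Suc m * k \<le> length p"
    "c \<in> W a \<rightarrow>\<^sub>E {..m}" "\<And>i. i \<le> m \<Longrightarrow> card (colour_class c (W a) i) = k"
    "\<And>i j. i \<le> m \<Longrightarrow> j \<le> m \<Longrightarrow>
      similar (nths p (colour_class c (W a) i)) (nths p (colour_class c (W a) j))"
      using \<open>k > 0\<close> unfolding W_def by (metis tight_twins_colouring)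
    then have "(a, c) \<in> I" "p \<in> E (a, c)"
      using p length_finite_permutations_of_set[OF p] by (auto simp: I_def E_def n_def)
    then show "p \<in> (\<Union>z\<in>I. E z)" by blast
  qed
  then have "card {p \<in> permutations_of_set A. \<exists>C. tight_twins (Suc m) k p C} \<le> card (\<Union>z\<in>I. E z)"
    using finI by (intro card_mono) (auto simp: E_def)
  also have "\<dots> \<le> (\<Sum>z\<in>I. card (E z))" using finI by (rule card_UN_le)
  finally have "real (card {p \<in> permutations_of_set A. \<exists>C. tight_twins (Suc m) k p C})
      \<le> (\<Sum>z\<in>I. real (card (E z)))" by (metis of_nat_le_iff of_nat_sum)
  also have "\<dots> \<le> (\<Sum>z\<in>I. (1 / fact k) ^ m * fact n)"
  proof (rule sum_mono)
    fix z assume "z \<in> I"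
    then obtain a c where z: "z = (a, c)" "a + Suc m * k \<le> n"
      "\<forall>i\<le>m. card (colour_class c (W a) i) = k" by (auto simp: I_def)
    have "W a \<subseteq> {..<card A}" using z by (auto simp: W_def n_def)
    then show "real (card (E z)) \<le> (1 / fact k) ^ m * fact n"
      unfolding z(1) E_def prod.case n_def
      using z by (intro card_similar_at_positions_le[OF A])
        (auto simp: colour_class_def disjoint_family_on_def)
  qed
  also have "\<dots> \<le> n * real (Suc m) ^ (Suc m * k) * ((1 / fact k) ^ m * fact n)"
    using cardI by (simp del: power_Suc of_nat_Suc add: mult_right_mono)
  finally show ?thesis by (simp add: n_def mult.assoc)
qed

lemma block_tight_twins_of_similar_blocks:
  assumes "distinct p" "k > 0" "a + r * k \<le> length p" "similar_blocks k r (drop a p)"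
  shows "\<exists>C. block_tight_twins r k p C"
proof -
  define S where "S = (\<lambda>i. {a + i * k..<a + i * k + k})"
  have end_le: "a + i * k + k \<le> a + r * k" if "i < r" for i
    using that mult_le_mono1[of "Suc i" r k] by simp
  have "inj_on S {..<r}" using assms(2) by (auto simp: inj_on_def S_def atLeastLessThan_eq_iff)
  then have "card (S ` {..<r}) = r" by (simp add: card_image)
  moreover have "disjoint (S ` {..<r})"
  proof (rule disjointI)
    fix X Y assume "X \<in> S ` {..<r}" "Y \<in> S ` {..<r}" "X \<noteq> Y"
    then obtain i j where ij: "X = S i" "Y = S j" "i \<noteq> j" by auto
    have "i * k + k \<le> j * k" if "i < j" for i j :: nat
      using that mult_le_mono1[of "Suc i" j k] by simp
    from this[of i j] this[of j i] show "X \<inter> Y = {}"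
      using ij by (cases i j rule: linorder_cases) (auto simp: S_def)
  qed
  moreover have "nths p (S i) = take k (drop (i * k) (drop a p))" if "i < r" for i
  proof -
    have "S i = (+) (a + i * k) ` {..<k}"
      by (simp add: S_def lessThan_atLeast0 image_add_atLeastLessThan add.commute)
    then have "nths p (S i) = take k (drop (a + i * k) p)"
      by (simp flip: nths_drop)
    then show ?thesis by (simp add: add.commute)
  qed
  then have "similar (nths p (S i)) (nths p (S j))" if "i < r" "j < r" for i j
    using that assms(1,4) by (subst similar_iff_ranks_eq) (auto simp: similar_blocks_def)
  moreover have "(\<Union>i<r. S i) = {a..<a + r * k}"
  proof (intro set_eqI iffI)
    fix x assume "x \<in> (\<Union>i<r. S i)"
    then show "x \<in> {a..<a + r * k}" using end_le by (force simp: S_def)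
  next
    fix x assume x: "x \<in> {a..<a + r * k}"
    define i where "i = (x - a) div k"
    have "i < r" using x assms(2) by (auto simp: i_def div_less_iff_less_mult)
    moreover have "i * k \<le> x - a" "x - a < i * k + k"
      using assms(2) dividend_less_div_times[of k "x - a"] by (auto simp: i_def)
    then have "x \<in> S i" using x by (auto simp: S_def)
    ultimately show "x \<in> (\<Union>i<r. S i)" by blast
  qed
  moreover have "S i \<subseteq> {..<length p}" "card (S i) = k" if "i < r" for i
    using end_le[OF that] assms(3) by (auto simp: S_def)
  ultimately have "block_tight_twins r k p (S ` {..<r})"
    using assms(2,3) unfolding block_tight_twins_def tight_twins_def
    by (auto simp: pairwise_def) (auto simp: S_def)
  then show ?thesis by blast
qed

section \<open>The largest twins\<close>

text \<open>
  This bound makes the sets of twin lengths finite, so that the maxima defining \<open>tt\<close> and \<open>btt\<close>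
  are genuine.
\<close>
lemma tight_twins_length_le:
  assumes "r > 0" "tight_twins r k p C"
  shows "k \<le> length p"
proof -
  have "k \<le> r * k" using assms(1) by simp
  also have "r * k \<le> length p" using assms(2) by (auto simp: tight_twins_def)
  finally show ?thesis .
qed

lemma le_btt:
  assumes "r > 0" "block_tight_twins r k p C"
  shows "k \<le> btt r p"
proof -
  have "{k. \<exists>C. block_tight_twins r k p C} \<subseteq> {..length p}"
    using tight_twins_length_le[OF assms(1)] by (auto simp: block_tight_twins_def)
  then show ?thesis
    unfolding btt_def using assms(2) finite_subset by (intro Max_ge) auto
qed

lemma btt_le_tt:
  assumes "r > 0"
  shows "btt r p \<le> tt r p"
proof -
  have "{k. \<exists>C. tight_twins r k p C} \<subseteq> {..length p}"
    using tight_twins_length_le[OF assms] by auto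
  then show ?thesis
    unfolding tt_def btt_def using finite_subset
    by (intro Max_mono) (auto simp: block_tight_twins_def)
qed

lemma tt_attained:
  assumes "r > 0" "tt r p > 0"
  shows "\<exists>C. tight_twins r (tt r p) p C"
proof -
  have "{k. \<exists>C. tight_twins r k p C} \<subseteq> {..length p}"
    using tight_twins_length_le[OF assms(1)] by auto
  then have "tt r p \<in> insert 0 {k. \<exists>C. tight_twins r k p C}"
    unfolding tt_def using finite_subset by (intro Max_in) auto
  then show ?thesis using assms(2) by auto
qed

section \<open>Probability bounds for a given twin length\<close>

lemma prob_random_perm:
  "measure_pmf.prob (random_perm n) {p. P p}
    = real (card {p \<in> permutations_of_set {1..int n}. P p}) / fact n"
proof -
  have "permutations_of_set {1..int n} \<inter> {p. P p} = {p \<in> permutations_of_set {1..int n}. P p}"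
    by auto
  then show ?thesis
    unfolding random_perm_def by (subst measure_pmf_of_set) auto
qed

lemma prob_tight_twins_le:
  assumes "k > 0"
  shows "measure_pmf.prob (random_perm n) {p. \<exists>C. tight_twins (Suc m) k p C}
    \<le> n * real (Suc m) ^ (Suc m * k) * (1 / fact k) ^ m"
  using card_tight_twins_le[of "{1..int n}" k m] assms
  by (simp add: prob_random_perm divide_le_eq del: of_nat_Suc power_Suc)

lemma prob_no_block_tight_twins_le:
  assumes "k > 0" "N * (Suc m * k) \<le> n"
  shows "measure_pmf.prob (random_perm n) {p. \<not> (\<exists>C. block_tight_twins (Suc m) k p C)}
    \<le> (1 - (1 / fact k) ^ m) ^ N"
proof -
  let ?s = "Suc m * k"
  have "\<exists>C. block_tight_twins (Suc m) k p C"
    if p: "p \<in> permutations_of_set {1..int n}" and j: "j < N" "similar_blocks k (Suc m) (drop (j * ?s) p)" for p j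
  proof (rule block_tight_twins_of_similar_blocks[OF _ assms(1) _ j(2)])
    have "j * ?s + ?s \<le> N * ?s" using j(1) mult_le_mono1[of "Suc j" N ?s] by simp
    then show "j * ?s + Suc m * k \<le> length p"
      using length_finite_permutations_of_set[OF p] assms(2) by simp
  qed (use p in \<open>auto simp: permutations_of_set_def\<close>)
  then have "card {p \<in> permutations_of_set {1..int n}. \<not> (\<exists>C. block_tight_twins (Suc m) k p C)}
     \<le> card {p \<in> permutations_of_set {1..int n}. \<forall>j<N. \<not> similar_blocks k (Suc m) (drop (j * ?s) p)}"
    by (intro card_mono) auto
  then have "real (card {p \<in> permutations_of_set {1..int n}. \<not> (\<exists>C. block_tight_twins (Suc m) k p C)})
     \<le> real (card {p \<in> permutations_of_set {1..int n}. \<forall>j<N. \<not> similar_blocks k (Suc m) (drop (j * ?s) p)})"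
    by simp
  also have "\<dots> = (1 - (1 / fact k) ^ m) ^ N * fact n"
    using card_no_similar_segment[of "{1..int n}" N m k] assms(2) by simp
  finally show ?thesis by (simp add: prob_random_perm divide_le_eq)
qed

section \<open>Tail bounds for the largest twin length\<close>

text \<open>
  The term of index \<open>k\<close> in the exponential series of \<open>k\<close> is at most the whole sum.
\<close>
lemma fact_ge_power_div_exp: "(real k / exp 1) ^ k \<le> fact k"
proof -
  have "(\<Sum>n\<in>{k}. real k ^ n / fact n) \<le> (\<Sum>n. real k ^ n / fact n)"
    using summable_exp[of "real k"] by (intro sum_le_suminf) (auto simp: field_simps)
  then have "real k ^ k / fact k \<le> exp (real k)" by (simp add: exp_def field_simps)
  also have "exp (real k) = exp 1 ^ k" by (simp flip: exp_of_nat_mult)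
  finally show ?thesis by (simp add: power_divide field_simps)
qed

lemma geometric_tail_le_powr:
  fixes q :: real
  assumes "0 < q" "q \<le> 1 / 2"
  shows "(\<Sum>k\<in>{k. x < real k \<and> k \<le> n}. q ^ k) \<le> 2 * q powr x"
proof -
  define K where "K = nat \<lceil>x\<rceil>"
  have K: "x \<le> real K" by (simp add: K_def real_nat_ceiling_ge)
  have "(\<Sum>k\<in>{k. x < real k \<and> k \<le> n}. q ^ k) \<le> (\<Sum>k\<in>{K..n}. q ^ k)"
    using assms by (intro sum_mono2) (auto simp: K_def)
  also have "\<dots> \<le> q ^ K / (1 - q)"
  proof (cases "K \<le> n")
    case True
    have "(\<Sum>k=K..n. q ^ k) = (q ^ K - q ^ Suc n) / (1 - q)"
      using True assms by (subst sum_gp) auto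
    then show ?thesis using assms by (simp add: divide_right_mono)
  next
    case False
    then show ?thesis using assms by simp
  qed
  also have "\<dots> \<le> q ^ K / (1 / 2)" using assms by (intro divide_left_mono) auto
  also have "\<dots> = 2 * q powr real K" using assms by (simp add: powr_realpow)
  also have "\<dots> \<le> 2 * q powr x" using assms K by (intro mult_left_mono powr_mono') auto
  finally show ?thesis .
qed

text \<open>
  Deleting an entry from each twin leaves gaps, so tight twins of one length do not directly
  give shorter ones, and the probabilities of all lengths above \<open>x\<close> are summed. Replacing \<open>k!\<close>
  by \<open>(k / e) ^ k \<ge> (x / e) ^ k\<close> bounds the sum by a geometric series of ratio \<open>q\<close>.
\<close>
lemma prob_tt_greater_le:
  assumes "x > 0" and q: "q = real (Suc m) ^ Suc m * (exp 1 / x) ^ m" "q \<le> 1 / 2"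
  shows "measure_pmf.prob (random_perm n) {p. x < real (tt (Suc m) p)} \<le> 2 * n * q powr x"
proof -
  let ?M = "random_perm n"
  let ?K = "{k. x < real k \<and> k \<le> n}"
  have "q > 0" using assms by simp
  have setM: "length p = n" if "p \<in> set_pmf ?M" for p
  proof -
    have "p \<in> permutations_of_set {1..int n}" using that by (simp add: random_perm_def)
    from length_finite_permutations_of_set[OF this] show ?thesis by simp
  qed
  have sub: "{p. x < real (tt (Suc m) p)} \<inter> set_pmf ?M \<subseteq> (\<Union>k\<in>?K. {p. \<exists>C. tight_twins (Suc m) k p C})"
  proof safe
    fix p assume p: "x < real (tt (Suc m) p)" "p \<in> set_pmf ?M"
    then have "\<exists>C. tight_twins (Suc m) (tt (Suc m) p) p C"
      using \<open>x > 0\<close> by (intro tt_attained) auto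
    moreover from this have "tt (Suc m) p \<le> n"
      using tight_twins_length_le setM[OF p(2)] by blast
    ultimately show "p \<in> (\<Union>k\<in>?K. {p. \<exists>C. tight_twins (Suc m) k p C})"
      using p by blast
  qed
  have bound: "measure_pmf.prob ?M {p. \<exists>C. tight_twins (Suc m) k p C} \<le> n * q ^ k" if "k \<in> ?K" for k
  proof -
    have k: "x < real k" "k > 0" using that \<open>x > 0\<close> by (auto intro: gr0I)
    have "(x / exp 1) ^ k \<le> (real k / exp 1) ^ k"
      using k \<open>x > 0\<close> by (intro power_mono divide_right_mono) auto
    also have "\<dots> \<le> fact k" by (rule fact_ge_power_div_exp)
    finally have "1 / fact k \<le> 1 / (x / exp 1) ^ k"
      using \<open>x > 0\<close> by (intro divide_left_mono) auto
    then have "1 / fact k \<le> (exp 1 / x) ^ k" by (simp add: power_divide)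
    then have "(1 / fact k) ^ m \<le> ((exp 1 / x) ^ k) ^ m" by (intro power_mono) auto
    then have "real n * real (Suc m) ^ (Suc m * k) * (1 / fact k) ^ m
        \<le> real n * real (Suc m) ^ (Suc m * k) * ((exp 1 / x) ^ k) ^ m"
      by (intro mult_left_mono) auto
    also have "\<dots> = n * q ^ k"
      by (simp only: q power_mult_distrib power_mult[symmetric] mult.commute[of m k] mult.assoc)
    finally show ?thesis using prob_tight_twins_le[OF k(2), of n m] by linarith
  qed
  have "measure_pmf.prob ?M {p. x < real (tt (Suc m) p)}
      = measure_pmf.prob ?M ({p. x < real (tt (Suc m) p)} \<inter> set_pmf ?M)"
    by (simp add: measure_Int_set_pmf)
  also have "\<dots> \<le> measure_pmf.prob ?M (\<Union>k\<in>?K. {p. \<exists>C. tight_twins (Suc m) k p C})"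
    using sub by (intro measure_pmf.finite_measure_mono) auto
  also have "\<dots> \<le> (\<Sum>k\<in>?K. measure_pmf.prob ?M {p. \<exists>C. tight_twins (Suc m) k p C})"
    by (intro measure_pmf.finite_measure_subadditive_finite) auto
  also have "\<dots> \<le> (\<Sum>k\<in>?K. n * q ^ k)" by (intro sum_mono bound)
  also have "\<dots> = n * (\<Sum>k\<in>?K. q ^ k)" by (simp add: sum_distrib_left)
  also have "\<dots> \<le> n * (2 * q powr x)"
    using geometric_tail_le_powr[OF \<open>q > 0\<close> q(2)] by (intro mult_left_mono) auto
  finally show ?thesis by (simp add: mult_ac)
qed

text \<open>
  It suffices to look for twins of the single length \<open>K = \<lceil>x\<rceil>\<close> inside \<open>\<lfloor>n / ((m + 1) K)\<rfloor>\<close> disjoint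
  segments. The exponent estimates their number times \<open>1 / (K!)\<^sup>m\<close> from below, with
  \<open>K! \<le> K ^ K\<close> and \<open>K \<le> x + 1\<close>.
\<close>
lemma prob_btt_less_le:
  fixes x :: real
  assumes "x > 0"
  shows "measure_pmf.prob (random_perm n) {p. real (btt (Suc m) p) < x}
    \<le> exp (- ((n / (Suc m * (x + 1)) - 1) * (x + 1) powr (- real m * (x + 1))))"
proof -
  define K where "K = nat \<lceil>x\<rceil>"
  define N where "N = n div (Suc m * K)"
  define w where "w = (x + 1) powr (- real m * (x + 1))"
  have K: "K > 0" "x \<le> real K" "real K \<le> x + 1" using assms unfolding K_def by linarith+
  have "{p. real (btt (Suc m) p) < x} \<subseteq> {p. \<not> (\<exists>C. block_tight_twins (Suc m) K p C)}"
    using K(2) le_btt[of "Suc m" K] by force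
  then have "measure_pmf.prob (random_perm n) {p. real (btt (Suc m) p) < x}
      \<le> measure_pmf.prob (random_perm n) {p. \<not> (\<exists>C. block_tight_twins (Suc m) K p C)}"
    by (intro measure_pmf.finite_measure_mono) auto
  also have "\<dots> \<le> (1 - (1 / fact K) ^ m) ^ N"
    by (intro prob_no_block_tight_twins_le K(1)) (simp add: N_def div_times_less_eq_dividend del: mult_Suc)
  also have "\<dots> \<le> exp (- ((1 / fact K) ^ m)) ^ N"
    using exp_ge_add_one_self[of "- ((1 / fact K) ^ m)"] power_le_one[of "1 / fact K :: real" m]
    by (intro power_mono) auto
  also have "\<dots> = exp (- (real N * (1 / fact K) ^ m))" by (simp flip: exp_of_nat_mult)
  also have "\<dots> \<le> exp (- ((n / (Suc m * (x + 1)) - 1) * w))"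
  proof -
    have "real n / real (Suc m * K) - 1 \<le> real N"
      using floor_divide_of_nat_eq[of n "Suc m * K", where 'a = real] unfolding N_def by linarith
    moreover have "real (Suc m * K) \<le> Suc m * (x + 1)"
      unfolding of_nat_mult using K by (intro mult_left_mono) auto
    then have "real n / (Suc m * (x + 1)) \<le> real n / real (Suc m * K)"
      using K(1) by (intro divide_left_mono) (auto simp del: mult_Suc)
    ultimately have N: "n / (Suc m * (x + 1)) - 1 \<le> real N" by linarith
    have "fact K \<le> real K ^ K" using fact_le_power[of K, where 'a = real] by simp
    also have "\<dots> = real K powr real K" using K(1) by (simp add: powr_realpow)
    also have "\<dots> \<le> (x + 1) powr real K" using K by (intro powr_mono2) auto
    also have "\<dots> \<le> (x + 1) powr (x + 1)" using K assms by (intro powr_mono) auto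
    finally have "fact K ^ m \<le> ((x + 1) powr (x + 1)) ^ m" by (intro power_mono) auto
    also have "\<dots> = (x + 1) powr (real m * (x + 1))"
      using assms by (simp add: powr_power)
    finally have "w \<le> (1 / fact K) ^ m"
      using assms by (simp add: w_def powr_minus power_divide inverse_eq_divide divide_left_mono)
    then have "real N * w \<le> real N * (1 / fact K) ^ m" by (intro mult_left_mono) auto
    moreover have "(n / (Suc m * (x + 1)) - 1) * w \<le> real N * w"
      using N by (intro mult_right_mono) (auto simp: w_def)
    ultimately show ?thesis by simp
  qed
  finally show ?thesis by (simp add: w_def)
qed

section \<open>Concentration\<close>

definition twin_scale :: "nat \<Rightarrow> real" where
  "twin_scale n = ln (real n) / ln (ln (real n))"

lemma twin_scale_at_top: "filterlim twin_scale at_top sequentially"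
  unfolding twin_scale_def by real_asymp

text \<open>
  The defining feature of the scale: if \<open>x \<approx> d ln n / ln (ln n)\<close>, then
  \<open>ln (x!) \<approx> x ln x \<approx> d ln n\<close>. The shift by \<open>c\<close> absorbs the rounding of \<open>x\<close> to an integer.
\<close>
lemma twin_scale_ln_twin_scale:
  assumes "d > 0"
  shows "(\<lambda>n. (d * twin_scale n + c) * ln (d * twin_scale n + c) / ln (real n)) \<longlonglongrightarrow> d"
  unfolding twin_scale_def using assms by real_asymp

lemma affine_twin_scale_div_ln:
  assumes "d > 0"
  shows "(\<lambda>n. (d * twin_scale n + c) / ln (real n)) \<longlonglongrightarrow> 0"
  unfolding twin_scale_def using assms by real_asymp

text \<open>
  At \<open>x = d ln n / ln (ln n)\<close> the tail bound is \<open>2 n ^ (1 - m d + o(1))\<close>, whose exponent is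
  eventually negative since \<open>m d > 1\<close>.
\<close>
lemma prob_tt_greater_tendsto_0:
  assumes "m > 0" "1 / real m < d"
  shows "(\<lambda>n. measure_pmf.prob (random_perm n) {p. d * twin_scale n < real (tt (Suc m) p)}) \<longlonglongrightarrow> 0"
proof -
  have d: "d > 0" "1 < real m * d"
    using assms less_trans[of 0 "1 / real m" d] by (auto simp: field_simps)
  define x where "x = (\<lambda>n. d * twin_scale n)"
  define B where "B = real (Suc m) ^ Suc m * exp 1 ^ m"
  define q where "q = (\<lambda>n. real (Suc m) ^ Suc m * (exp 1 / x n) ^ m)"
  have "B > 0" by (simp add: B_def)
  have x_top: "filterlim x at_top sequentially"
    unfolding x_def by (intro filterlim_tendsto_pos_mult_at_top[OF tendsto_const] d twin_scale_at_top)
  have "((\<lambda>n. exp 1 / x n) \<longlonglongrightarrow> 0)"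
    by (intro tendsto_divide_0[OF tendsto_const] filterlim_at_top_imp_at_infinity x_top)
  then have "q \<longlonglongrightarrow> real (Suc m) ^ Suc m * 0 ^ m" unfolding q_def by (intro tendsto_intros)
  then have "q \<longlonglongrightarrow> 0" using assms(1) by (simp add: power_0_left)
  then have ev_q: "eventually (\<lambda>n. q n < 1 / 2) sequentially" by (rule order_tendstoD) simp
  have ev_x: "eventually (\<lambda>n. x n > 0) sequentially" using x_top by (simp add: filterlim_at_top_dense)
  \<comment> \<open>The tail bound equals \<open>2 * n powr e n\<close>.\<close>
  define e where "e = (\<lambda>n. 1 + ln B * (x n / ln n) - m * (x n * ln (x n) / ln n))"
  have "e \<longlonglongrightarrow> 1 + ln B * 0 - m * d"
    unfolding e_def x_def
    using affine_twin_scale_div_ln[OF d(1), of 0] twin_scale_ln_twin_scale[OF d(1), of 0]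
    by (intro tendsto_intros) simp_all
  then have "filterlim (\<lambda>n. e n * ln (real n)) at_bot sequentially"
  proof (rule filterlim_tendsto_neg_mult_at_bot)
    show "filterlim (\<lambda>n. ln (real n)) at_top sequentially" by real_asymp
  qed (use d in simp)
  then have "(\<lambda>n. 2 * exp (e n * ln (real n))) \<longlonglongrightarrow> 2 * 0"
    by (intro tendsto_intros filterlim_compose[OF exp_at_bot])
  then have lim: "(\<lambda>n. 2 * exp (e n * ln (real n))) \<longlonglongrightarrow> 0" by simp
  have "eventually (\<lambda>n. measure_pmf.prob (random_perm n) {p. x n < real (tt (Suc m) p)}
      \<le> 2 * exp (e n * ln (real n))) sequentially"
    using ev_q ev_x eventually_gt_at_top[of 1]
  proof eventually_elim
    case (elim n)
    have "q n = B / x n ^ m" by (simp add: q_def B_def power_divide)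
    then have "ln (q n) = ln B - m * ln (x n)" 
      using elim \<open>B > 0\<close> by (simp add: ln_div ln_realpow)
    moreover have "q n > 0" using elim by (simp add: q_def)
    ultimately have "n * q n powr x n = exp (ln n) * exp (x n * (ln B - m * ln (x n)))"
      using elim by (simp add: powr_def)
    also have "\<dots> = exp (e n * ln n)"
    proof -
      have "e n * ln n = ln n + x n * (ln B - m * ln (x n))"
        using elim by (simp add: e_def distrib_left right_diff_distrib left_diff_distrib distrib_right)
      then show ?thesis by (simp add: exp_add)
    qed
    finally have "2 * n * q n powr x n = 2 * exp (e n * ln n)" by simp
    then show ?case
      using prob_tt_greater_le[OF elim(2), of "q n" m n] elim(1) by (simp only: q_def) simp
  qed
  then show ?thesis
    using tendsto_sandwich[OF always_eventually _ tendsto_const lim] by (simp add: x_def)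
qed

text \<open>
  At \<open>x = d ln n / ln (ln n)\<close> the expected number of good segments is \<open>n ^ (1 - m d + o(1))\<close>,
  which tends to infinity when \<open>m d < 1\<close>.
\<close>
lemma prob_btt_less_tendsto_0:
  assumes "m > 0" "d < 1 / real m"
  shows "(\<lambda>n. measure_pmf.prob (random_perm n) {p. real (btt (Suc m) p) < d * twin_scale n}) \<longlonglongrightarrow> 0"
proof -
  \<comment> \<open>Raising \<open>d\<close> to a positive value only enlarges the event and makes the length bound positive.\<close>
  define d' where "d' = max d (1 / (2 * real m))"
  have "0 < 1 / (2 * real m)" "1 / (2 * real m) \<le> d'" "d \<le> d'" "d' < 1 / real m"
    using assms by (auto simp: d'_def field_simps)
  moreover from this have "d' > 0" by linarith
  ultimately have d': "d' > 0" "real m * d' < 1" "d \<le> d'" using assms(1) by (auto simp: field_simps)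
  define x where "x = (\<lambda>n. d' * twin_scale n)"
  have x_top: "filterlim x at_top sequentially"
    unfolding x_def by (intro filterlim_tendsto_pos_mult_at_top[OF tendsto_const] d' twin_scale_at_top)
  then have ev_x: "eventually (\<lambda>n. x n > 0) sequentially" by (simp add: filterlim_at_top_dense)
  define g where "g = (\<lambda>n. (n / (Suc m * (x n + 1)) - 1) * (x n + 1) powr (- real m * (x n + 1)))"
  \<comment> \<open>Up to the bounded term \<open>- 1\<close> and the factor \<open>1 / (m + 1)\<close>, \<open>g n\<close> is at least \<open>n powr e n\<close>.\<close>
  define e where "e = (\<lambda>n. 1 - m * ((x n + 1) * ln (x n + 1) / ln n) - ln (x n + 1) / ln n)"
  have "(\<lambda>n. ln (x n + 1) / ln (real n)) \<longlonglongrightarrow> 0"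
    unfolding x_def twin_scale_def using d'(1) by real_asymp
  then have "e \<longlonglongrightarrow> 1 - m * d' - 0"
    unfolding e_def x_def using twin_scale_ln_twin_scale[OF d'(1), of 1] by (intro tendsto_intros)
  then have "filterlim (\<lambda>n. e n * ln (real n)) at_top sequentially"
  proof (rule filterlim_tendsto_pos_mult_at_top)
    show "filterlim (\<lambda>n. ln (real n)) at_top sequentially" by real_asymp
  qed (use d' in simp)
  then have "filterlim (\<lambda>n. 1 / Suc m * exp (e n * ln (real n))) at_top sequentially"
    by (intro filterlim_tendsto_pos_mult_at_top[OF tendsto_const] filterlim_compose[OF exp_at_top]) simp_all
  then have "filterlim (\<lambda>n. - 1 + 1 / Suc m * exp (e n * ln (real n))) at_top sequentially"
    by (intro filterlim_tendsto_add_at_top[OF tendsto_const])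
  moreover have "eventually (\<lambda>n. - 1 + 1 / Suc m * exp (e n * ln (real n)) \<le> g n) sequentially"
    using ev_x eventually_gt_at_top[of 1]
  proof eventually_elim
    case (elim n)
    define y where "y = x n + 1"
    have y: "y > 1" using elim by (simp add: y_def)
    have "exp (e n * ln n) = exp (ln n + (- ln y) + (- m * y * ln y))"
      using elim by (simp add: e_def y_def field_simps)
    also have "\<dots> = n / y * y powr (- m * y)"
      using elim y by (simp only: exp_add exp_minus) (simp add: powr_def field_simps exp_minus)
    finally have "1 / Suc m * exp (e n * ln n) = n / (Suc m * y) * y powr (- real m * y)" by simp
    moreover have "y powr (- real m * y) \<le> 1" using y powr_mono[of "- real m * y" 0 y] by simp
    ultimately show ?case by (simp add: g_def left_diff_distrib flip: y_def)
  qed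
  ultimately have "filterlim g at_top sequentially" by (rule filterlim_at_top_mono)
  then have lim: "(\<lambda>n. exp (- g n)) \<longlonglongrightarrow> 0"
    using filterlim_compose[OF exp_at_bot filterlim_uminus_at_top[THEN iffD1]] by blast
  have "eventually (\<lambda>n. measure_pmf.prob (random_perm n) {p. real (btt (Suc m) p) < d * twin_scale n}
      \<le> exp (- g n)) sequentially"
    using ev_x
  proof eventually_elim
    case (elim n)
    then have "twin_scale n > 0" using d'(1) by (simp add: x_def zero_less_mult_iff)
    then have "d * twin_scale n \<le> x n" using d'(3) by (simp add: x_def mult_right_mono)
    then have "measure_pmf.prob (random_perm n) {p. real (btt (Suc m) p) < d * twin_scale n}
        \<le> measure_pmf.prob (random_perm n) {p. real (btt (Suc m) p) < x n}"
      by (intro measure_pmf.finite_measure_mono) auto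
    also have "\<dots> \<le> exp (- g n)" unfolding g_def using prob_btt_less_le[OF elim] by simp
    finally show ?case .
  qed
  then show ?thesis
    using tendsto_sandwich[OF always_eventually _ tendsto_const lim] by simp
qed

lemma aas_asymp_between_btt_tt:
  assumes "m > 0" and X: "\<And>p. btt (Suc m) p \<le> X p" "\<And>p. X p \<le> tt (Suc m) p"
  shows "aas_asymp X (1 / real m) twin_scale"
  unfolding aas_asymp_def aas_def
proof (intro allI impI)
  fix \<epsilon> :: real assume "\<epsilon> > 0"
  define lo where "lo = (\<lambda>n. {p. real (btt (Suc m) p) < (1 / real m - \<epsilon>) * twin_scale n})"
  define hi where "hi = (\<lambda>n. {p. (1 / real m + \<epsilon>) * twin_scale n < real (tt (Suc m) p)})"
  define good where "good = (\<lambda>n. {p. (1 / real m - \<epsilon>) * twin_scale n \<le> real (X p)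
    \<and> real (X p) \<le> (1 / real m + \<epsilon>) * twin_scale n})"
  have lower: "1 - (measure_pmf.prob (random_perm n) (lo n) + measure_pmf.prob (random_perm n) (hi n))
      \<le> measure_pmf.prob (random_perm n) (good n)" for n
  proof -
    have "- good n \<subseteq> lo n \<union> hi n"
    proof
      fix p assume "p \<in> - good n"
      then show "p \<in> lo n \<union> hi n" using X[of p] by (auto simp: good_def lo_def hi_def)
    qed
    then have "measure_pmf.prob (random_perm n) (- good n) \<le> measure_pmf.prob (random_perm n) (lo n \<union> hi n)"
      by (intro measure_pmf.finite_measure_mono) auto
    also have "\<dots> \<le> measure_pmf.prob (random_perm n) (lo n) + measure_pmf.prob (random_perm n) (hi n)"
      by (intro measure_Un_le) auto
    finally show ?thesis using measure_pmf.prob_compl[of "good n" "random_perm n"]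
      by (simp add: Compl_eq_Diff_UNIV)
  qed
  have "(\<lambda>n. 1 - (measure_pmf.prob (random_perm n) (lo n) + measure_pmf.prob (random_perm n) (hi n)))
      \<longlonglongrightarrow> 1 - (0 + 0)"
    unfolding lo_def hi_def using \<open>\<epsilon> > 0\<close> assms(1)
    by (intro tendsto_intros prob_btt_less_tendsto_0 prob_tt_greater_tendsto_0) auto
  then have "(\<lambda>n. 1 - (measure_pmf.prob (random_perm n) (lo n) + measure_pmf.prob (random_perm n) (hi n)))
      \<longlonglongrightarrow> 1" by simp
  then have "(\<lambda>n. measure_pmf.prob (random_perm n) (good n)) \<longlonglongrightarrow> 1"
    by (rule tendsto_sandwich[OF _ _ _ tendsto_const, rotated -1])
      (simp_all add: lower measure_pmf.prob_le_1)
  then show "(\<lambda>n. measure_pmf.prob (random_perm n) {p. (1 / real m - \<epsilon>) * twin_scale n \<le> real (X p)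
    \<and> real (X p) \<le> (1 / real m + \<epsilon>) * twin_scale n}) \<longlonglongrightarrow> 1"
    by (simp add: good_def)
qed

theorem theorem5p2:
  fixes r :: nat
  assumes "r \<ge> 2"
  shows "aas_asymp (tt r) (1 / (real r - 1)) (\<lambda>n. ln (real n) / ln (ln (real n)))
       \<and> aas_asymp (btt r) (1 / (real r - 1)) (\<lambda>n. ln (real n) / ln (ln (real n)))"
proof -
  obtain m where m: "r = Suc m" "m > 0" using assms by (cases r) auto
  have "(\<lambda>n. ln (real n) / ln (ln (real n))) = twin_scale" by (simp add: twin_scale_def fun_eq_iff)
  then show ?thesis
    using aas_asymp_between_btt_tt[OF m(2), of "tt r"] aas_asymp_between_btt_tt[OF m(2), of "btt r"] m
    by (simp add: btt_le_tt)
qed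

end
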